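(* Let $X$ be a finite set with at least three elements and let $\mathcal{P}=\{X_i \mid i\in I_m\}$ be a partition of $X$ into exactly $m$ blocks. Then every regular element of the semigroup $\Gamma(X,\mathcal{P})$ is unit-regular in $\Gamma(X,\mathcal{P})$.
   Context: Maps are written on the right and composed from left to right; $Af$ is the image of a subset $A$ under $f$. $I_m=\{1,\dots,m\}$. A partition of $X$ is a collection of nonempty pairwise disjoint subsets (blocks) with union $X$; distinct indices correspond to distinct blocks. $\mathcal{T}_X$ is the semigroup of all maps $X\to X$ under composition. $\Gamma(X,\mathcal{P})=\{f\in\mathcal{T}_X \mid (\forall X_i\in\mathcal{P})(\exists X_j\in\mathcal{P})\; X_if=X_j\}$, a semigroup under composition containing the identity map. An element $a$ of a semigroup $S$ with identity is regular if there is $b\in S$ with $a=aba$, and unit-regular if there is a unit (invertible element) $u\in S$ with $a=aua$. *)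

theory Defs
  imports "HOL-Algebra.Group" "HOL-Library.FuncSet" "HOL-Library.Disjoint_Sets"
begin

text \<open>
  Maps \<open>X \<rightarrow> X\<close> are represented by extensional functions. Maps are written on the right and
  composed from left to right, so the product of \<open>f\<close> and \<open>g\<close> applies \<open>f\<close> first.
\<close>

definition full_transf :: "'a set \<Rightarrow> ('a \<Rightarrow> 'a) monoid" where
  "full_transf X =
    \<lparr>carrier = X \<rightarrow>\<^sub>E X, mult = (\<lambda>f g. compose X g f), one = (\<lambda>x\<in>X. x)\<rparr>"

definition Gamma_transf :: "'a set \<Rightarrow> 'a set set \<Rightarrow> ('a \<Rightarrow> 'a) monoid" where
  "Gamma_transf X P =
    (full_transf X)\<lparr>carrier := {f \<in> carrier (full_transf X). \<forall>A\<in>P. \<exists>B\<in>P. f ` A = B}\<rparr>"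

definition regular_elem :: "('a, 'b) monoid_scheme \<Rightarrow> 'a \<Rightarrow> bool" where
  "regular_elem S a \<longleftrightarrow>
    a \<in> carrier S \<and> (\<exists>b\<in>carrier S. a = a \<otimes>\<^bsub>S\<^esub> b \<otimes>\<^bsub>S\<^esub> a)"

definition unit_regular_elem :: "('a, 'b) monoid_scheme \<Rightarrow> 'a \<Rightarrow> bool" where
  "unit_regular_elem S a \<longleftrightarrow>
    a \<in> carrier S \<and> (\<exists>u\<in>Units S. a = a \<otimes>\<^bsub>S\<^esub> u \<otimes>\<^bsub>S\<^esub> a)"

lemma monoid_full_transf: "monoid (full_transf X)"
  by (rule monoidI)
    (auto simp: full_transf_def compose_def PiE_def extensional_def Pi_def fun_eq_iff)

lemma monoid_Gamma_transf:
  assumes "partition_on X P"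
  shows "monoid (Gamma_transf X P)"
proof -
  have sub: "A \<subseteq> X" if "A \<in> P" for A
    using assms that by (auto simp: partition_on_def)
  have comp: "\<exists>B\<in>P. compose X g f ` A = B"
    if "\<forall>A\<in>P. \<exists>B\<in>P. f ` A = B" "\<forall>A\<in>P. \<exists>B\<in>P. g ` A = B" "A \<in> P" for f g A
  proof -
    have "compose X g f ` A = g ` (f ` A)"
      using sub[OF that(3)] by (force simp: compose_def image_image)
    then show ?thesis using that by auto
  qed
  have one: "\<exists>B\<in>P. (\<lambda>x\<in>X. x) ` A = B" if "A \<in> P" for A
    using that sub[OF that] by (auto simp: subset_iff image_iff)
  interpret T: monoid "full_transf X" by (rule monoid_full_transf)
  show ?thesis
  proof (rule monoidI)
    fix f g assume "f \<in> carrier (Gamma_transf X P)" "g \<in> carrier (Gamma_transf X P)"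
    then show "f \<otimes>\<^bsub>Gamma_transf X P\<^esub> g \<in> carrier (Gamma_transf X P)"
      using T.m_closed[of f g] comp[of f g]
      by (simp add: Gamma_transf_def) (simp add: full_transf_def)
  next
    show "\<one>\<^bsub>Gamma_transf X P\<^esub> \<in> carrier (Gamma_transf X P)"
      using T.one_closed one by (simp add: Gamma_transf_def) (simp add: full_transf_def)
  qed (auto simp: Gamma_transf_def T.m_assoc)
qed

end

theory Submission
  imports Defs
begin

text \<open>
  Let \<open>a = a b a\<close> in \<open>\<Gamma>(X, P)\<close>. The image \<open>X a\<close> is a union of blocks, and on it \<open>b\<close> is a section
  of \<open>a\<close>: following \<open>b\<close> by \<open>a\<close> fixes every point of \<open>X a\<close>. So \<open>b\<close> is injective on \<open>X a\<close>, and it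
  carries each block inside \<open>X a\<close> bijectively onto a block. Any unit that agrees with \<open>b\<close> on \<open>X a\<close>
  can replace \<open>b\<close> in \<open>a = a b a\<close>, because there the middle factor is only ever applied to points
  of \<open>X a\<close>.

  Such a unit exists by counting. The restriction of \<open>b\<close> matches the blocks inside \<open>X a\<close> with
  blocks of \<open>P\<close> injectively and preserves block sizes. Since there are only finitely many blocks,
  for each size as many blocks lie outside \<open>X a\<close> as are missed by the matching. The remaining blocks
  can therefore be matched too, and bijections between blocks of equal size extend \<open>b\<close> to a
  permutation of \<open>X\<close> (lemma \<open>block_injection_extends\<close>). A permutation that sends blocks to blocks
  permutes the finite set of blocks, so its inverse also sends blocks to blocks, and it is a unit
  (lemma \<open>block_permutation_Units\<close>).
\<close>

lemma image_block_subset: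
  assumes "partition_on X P" and "\<forall>A\<in>P. h ` A \<in> P"
  shows "h ` X \<subseteq> X"
  using assms by (auto simp: partition_on_def)

lemma carrier_Gamma_transf:
  "f \<in> carrier (Gamma_transf X P) \<longleftrightarrow> f \<in> X \<rightarrow>\<^sub>E X \<and> (\<forall>A\<in>P. f ` A \<in> P)"
  by (auto simp: Gamma_transf_def full_transf_def)

lemma mult_Gamma_transf: "f \<otimes>\<^bsub>Gamma_transf X P\<^esub> g = compose X g f"
  by (simp add: Gamma_transf_def full_transf_def)

lemma one_Gamma_transf: "\<one>\<^bsub>Gamma_transf X P\<^esub> = (\<lambda>x\<in>X. x)"
  by (simp add: Gamma_transf_def full_transf_def)

text \<open>
  The target for one further block \<open>A\<close> comes from comparing, among the blocks of size \<open>card A\<close>,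
  those already in the domain with all of them: \<open>A\<close> shows that the former are strictly fewer, so
  their images cannot exhaust the latter.
\<close>

lemma unused_block_of_same_card:
  assumes fin: "finite X" and P: "partition_on X P" and R: "R \<subseteq> P"
    and inj: "inj_on g (\<Union>R)" and blocks: "\<forall>C\<in>R. g ` C \<in> P"
    and A: "A \<in> P" "A \<notin> R"
  obtains D where "D \<in> P" "D \<notin> (`) g ` R" "card D = card A"
proof -
  let ?Q = "{C \<in> P. card C = card A}" and ?S = "{C \<in> R. card C = card A}"
  have "finite P" using fin P by (rule finite_elements)
  then have finQ: "finite ?Q" by simp
  have "?S \<subset> ?Q" using R A by auto
  then have "card ?S < card ?Q" using finQ by (rule psubset_card_mono[rotated])
  then have "card ((`) g ` ?S) < card ?Q"
    using finQ \<open>?S \<subset> ?Q\<close>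
    by (meson card_image_le finite_subset le_less_trans psubset_imp_subset)
  then have "\<not> ?Q \<subseteq> (`) g ` ?S"
    using finQ \<open>?S \<subset> ?Q\<close>
    by (meson card_mono finite_imageI finite_subset not_le psubset_imp_subset)
  then obtain D where D: "D \<in> P" "card D = card A" "D \<notin> (`) g ` ?S" by auto
  have "card (g ` C) = card C" if "C \<in> R" for C
    using inj that by (auto intro!: card_image elim: inj_on_subset)
  then have "D \<notin> (`) g ` R" using D by auto
  with D that show thesis by blast
qed

text \<open>
  The map is enlarged one block at a time, which keeps it defined on points throughout: no global
  permutation of blocks has to be chosen and lifted to points afterwards.
\<close>

lemma block_injection_extends:
  assumes fin: "finite X" and P: "partition_on X P" and "R \<subseteq> P"
    and "inj_on g (\<Union>R)" and "\<forall>A\<in>R. g ` A \<in> P"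
  shows "\<exists>h. (\<forall>x\<in>\<Union>R. h x = g x) \<and> inj_on h X \<and> (\<forall>A\<in>P. h ` A \<in> P)"
  using assms(3-5)
proof (induction "card (P - R)" arbitrary: R g rule: less_induct)
  case less
  have finP: "finite P" using fin P by (rule finite_elements)
  have disj: "C \<inter> D = {}" if "C \<in> P" "D \<in> P" "C \<noteq> D" for C D
    using P that by (auto simp: partition_on_def disjoint_def)
  have finite_block: "finite C" if "C \<in> P" for C
    using P fin that by (metis Sup_upper finite_subset partition_onD1)
  show ?case
  proof (cases "R = P")
    case True
    with less.prems P show ?thesis by (auto simp: partition_on_def)
  next
    case False
    then obtain A where A: "A \<in> P" "A \<notin> R" using less.prems by auto
    obtain D where D: "D \<in> P" "D \<notin> (`) g ` R" "card D = card A"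
      using unused_block_of_same_card[OF fin P less.prems A] by blast
    obtain k where k: "bij_betw k A D"
      using finite_block A(1) D(1,3) by (metis bij_betw_iff_card)
    define g' where "g' x = (if x \<in> A then k x else g x)" for x
    have off_A: "g' x = g x" if "x \<in> \<Union>R" for x
      using that A disj[of _ A] less.prems(1) by (fastforce simp: g'_def)
    have on_A: "g' x = k x" if "x \<in> A" for x
      using that by (simp add: g'_def)
    have img_A: "g' ` A = D"
      using k on_A by (auto simp: bij_betw_def)
    have img_R: "g' ` C = g ` C" if "C \<in> R" for C
      using that off_A by (intro image_cong) auto
    have "g ` C \<inter> D = {}" if "C \<in> R" for C
      using that D less.prems(3) by (intro disj) auto
    then have "g' ` \<Union>R \<inter> g' ` A = {}"
      using img_R img_A by (auto simp: image_Union)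
    moreover have "inj_on g' (\<Union>R)"
      using less.prems(2) inj_on_cong[of "\<Union>R" g' g, OF off_A] by simp
    moreover have "inj_on g' A"
      using k inj_on_cong[of A g' k, OF on_A] by (simp add: bij_betw_def)
    ultimately have "inj_on g' (\<Union>R \<union> A)"
      unfolding inj_on_Un by blast
    then have "inj_on g' (\<Union>(insert A R))"
      by (simp add: Un_commute)
    moreover have "\<forall>C\<in>insert A R. g' ` C \<in> P"
      using img_A img_R D less.prems by auto
    moreover have "card (P - insert A R) < card (P - R)"
      using A finP by (intro psubset_card_mono) auto
    moreover have "insert A R \<subseteq> P" using A less.prems by auto
    ultimately obtain h where h: "\<forall>x\<in>\<Union>(insert A R). h x = g' x" "inj_on h X" "\<forall>A\<in>P. h ` A \<in> P"
      using less.hyps[of "insert A R" g'] by blast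
    then have "\<forall>x\<in>\<Union>R. h x = g x" using off_A by auto
    with h show ?thesis by blast
  qed
qed

text \<open>
  By finiteness an injective self-map of the set of blocks is onto, so every block is the image
  of a block, and this is what puts the inverse map into \<open>\<Gamma>(X, P)\<close>.
\<close>

lemma block_permutation_Units:
  assumes fin: "finite X" and P: "partition_on X P"
    and inj: "inj_on h X" and blocks: "\<forall>A\<in>P. h ` A \<in> P"
  shows "restrict h X \<in> Units (Gamma_transf X P)"
proof -
  have sub: "C \<subseteq> X" if "C \<in> P" for C
    using P that by (auto simp: partition_on_def)
  have bij: "h ` X = X"
    using image_block_subset[OF P blocks] inj fin by (metis endo_inj_surj)
  have "(`) h ` P = P"
  proof (rule endo_inj_surj)
    show "finite P" using fin P by (rule finite_elements)
    show "(`) h ` P \<subseteq> P" using blocks by auto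
    show "inj_on ((`) h) P"
      using inj_on_image_Pow[OF inj] by (rule inj_on_subset) (use sub in auto)
  qed
  then have preimage: "\<exists>C\<in>P. D = h ` C" if "D \<in> P" for D
    using that by blast
  let ?k = "inv_into X h"
  have k_block: "restrict ?k X ` D \<in> P" if D: "D \<in> P" for D
  proof -
    obtain C where C: "C \<in> P" "D = h ` C" using preimage[OF D] by blast
    have "restrict ?k X ` D = ?k ` D" using sub[OF D] by (auto simp: image_iff)
    also have "\<dots> = C" using C sub inj by (simp add: inv_into_image_cancel)
    finally show ?thesis using C by simp
  qed
  have h_block: "restrict h X ` D \<in> P" if D: "D \<in> P" for D
  proof -
    have "restrict h X ` D = h ` D" using sub[OF D] by (intro image_cong) auto
    then show ?thesis using blocks D by simp
  qed
  have into: "h x \<in> X" "?k x \<in> X" if "x \<in> X" for x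
    using that bij inv_into_into[of x h X] by auto
  have cancel: "?k (h x) = x" "h (?k x) = x" if "x \<in> X" for x
    using that bij inj by (auto simp: f_inv_into_f)
  have "restrict h X \<in> carrier (Gamma_transf X P)" "restrict ?k X \<in> carrier (Gamma_transf X P)"
    using h_block k_block into by (auto simp: carrier_Gamma_transf)
  moreover have "compose X (restrict ?k X) (restrict h X) = (\<lambda>x\<in>X. x)"
    "compose X (restrict h X) (restrict ?k X) = (\<lambda>x\<in>X. x)"
    using into cancel by (auto simp: compose_def fun_eq_iff)
  ultimately show ?thesis
    by (auto simp: Units_def mult_Gamma_transf one_Gamma_transf)
qed

theorem proposition5p8:
  fixes X :: "'a set" and P :: "'a set set" and B :: "nat \<Rightarrow> 'a set" and m :: nat
  assumes "finite X" and "card X \<ge> 3"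
    and "partition_on X P"
    and "P = B ` {1..m}" and "inj_on B {1..m}"
  shows "\<forall>a\<in>carrier (Gamma_transf X P).
           regular_elem (Gamma_transf X P) a \<longrightarrow> unit_regular_elem (Gamma_transf X P) a"
proof (intro ballI impI)
  fix a
  assume a: "a \<in> carrier (Gamma_transf X P)" and "regular_elem (Gamma_transf X P) a"
  then obtain b where b: "b \<in> carrier (Gamma_transf X P)"
    and aba: "a = compose X a (compose X b a)"
    by (auto simp: regular_elem_def mult_Gamma_transf)
  have aX: "a x \<in> X" if "x \<in> X" for x
    using a that by (auto simp: carrier_Gamma_transf)
  have aba_at: "a (b (a x)) = a x" if "x \<in> X" for x
    using that fun_cong[OF aba, of x] by (simp add: compose_def)
  let ?R = "(`) a ` P"
  have image_a: "\<Union>?R = a ` X"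
    using assms(3) by (auto simp: partition_on_def)
  have "inj_on b (\<Union>?R)"
    unfolding image_a by (rule inj_on_inverseI[where g = a]) (auto simp: aba_at)
  moreover have "?R \<subseteq> P" "\<forall>A\<in>?R. b ` A \<in> P"
    using a b by (auto simp: carrier_Gamma_transf)
  ultimately obtain h where h: "\<forall>y\<in>a ` X. h y = b y" "inj_on h X" "\<forall>A\<in>P. h ` A \<in> P"
    using block_injection_extends[OF assms(1,3)] image_a by metis
  have unit: "restrict h X \<in> Units (Gamma_transf X P)"
    using block_permutation_Units[OF assms(1,3) h(2,3)] .
  have "a = compose X a (compose X (restrict h X) a)"
  proof
    fix x
    show "a x = compose X a (compose X (restrict h X) a) x"
    proof (cases "x \<in> X")
      case True
      then show ?thesis using h(1) aX aba_at by (simp add: compose_def)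
    next
      case False
      then show ?thesis using a by (auto simp: compose_def carrier_Gamma_transf PiE_def extensional_def)
    qed
  qed
  then show "unit_regular_elem (Gamma_transf X P) a"
    using a unit by (auto simp: unit_regular_elem_def mult_Gamma_transf)
qed

end
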